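(* Let $\lambda$ and $\mu$ be infinite regular cardinals and let $\kappa$ be an infinite cardinal. Then the following three conditions are equivalent. (a) There is a family $(B_{\alpha,\beta})_{\alpha<\mu,\ \beta<\kappa}$ of subsets of $\lambda$ such that: (i) for every $\beta<\kappa$, $\bigcup_{\alpha<\mu} B_{\alpha,\beta}=\lambda$; (ii) for every $\beta<\kappa$ and all $\alpha\le\alpha'<\mu$, $B_{\alpha,\beta}\subseteq B_{\alpha',\beta}$; (iii) for every function $f:\kappa\to\mu$ there exists a finite subset $F\subseteq\kappa$ such that $\left|\bigcap_{\beta\in F} B_{f(\beta),\beta}\right|<\lambda$. (b) Whenever $(X_\beta)_{\beta<\kappa}$ is a family of topological spaces such that no $X_\beta$ is $[\mu,\mu]$-compact, the product $X=\prod_{\beta<\kappa}X_\beta$ (with the Tychonoff topology) is not $[\lambda,\lambda]$-compact. (c) The topological space $\mu^\kappa$ is not $[\lambda,\lambda]$-compact, where $\mu$ is endowed with the topology whose open sets are exactly the intervals $[0,\alpha)$ for $\alpha\le\mu$, and $\mu^\kappa$ is endowed with the Tychonoff product topology.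
   Context: Cardinals are identified with initial ordinals; the Axiom of Choice is assumed. For infinite cardinals $\kappa,\lambda$, a topological space is called $[\kappa,\lambda]$-compact if every open cover of it consisting of at most $\lambda$ sets has a subcover consisting of fewer than $\kappa$ sets. The Tychonoff topology on a product is the smallest topology making all canonical projections continuous; $\mu^\kappa$ denotes the product of $\kappa$ copies of $\mu$. No separation axioms are assumed on the spaces. *)

theory Defs
  imports "HOL-Analysis.Analysis"
begin

text \<open>
  Infinite cardinals are represented by cardinal orders \<open>r\<close> with infinite field: the elements of
  \<open>Field r\<close> play the role of the ordinals below the cardinal, and \<open>(a, b) \<in> r\<close> that of
  \<open>a \<le> b\<close>. Regularity is \<^const>\<open>regularCard\<close>; its notion of cofinal set is strict
  (every element has a strictly larger one in the set), which for infinite cardinals, having no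
  largest element, agrees with unboundedness.
\<close>

unbundle cardinal_syntax

definition cardinal_interval_compact :: "'k rel \<Rightarrow> 'l rel \<Rightarrow> 'c topology \<Rightarrow> bool"
  where "cardinal_interval_compact kap lam X \<longleftrightarrow>
    (\<forall>\<U>. (\<forall>U\<in>\<U>. openin X U) \<and> \<Union>\<U> = topspace X \<and> |\<U>| \<le>o lam \<longrightarrow>
      (\<exists>\<V>\<subseteq>\<U>. \<Union>\<V> = topspace X \<and> |\<V>| <o kap))"

text \<open>
  The initial segment \<open>[0, a)\<close> is \<open>underS r a\<close> for \<open>a\<close> below the cardinal, and the whole of
  \<open>Field r\<close> when \<open>a\<close> is the cardinal itself. These sets form a topology when \<open>r\<close> is a well-order;
  otherwise \<^const>\<open>topology\<close> is applied outside its intended domain.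
\<close>

definition initial_segment_topology :: "'m rel \<Rightarrow> 'm topology"
  where "initial_segment_topology r =
    topology (\<lambda>U. (\<exists>a\<in>Field r. U = underS r a) \<or> U = Field r)"

lemma istopology_initial_segments:
  assumes "Well_order r" and "Field r \<noteq> {}"
  shows "istopology (\<lambda>U. (\<exists>a\<in>Field r. U = underS r a) \<or> U = Field r)"
proof -
  interpret wo_rel r
    using assms(1) by (simp add: wo_rel_def)
  have eq: "(\<lambda>U. (\<exists>a\<in>Field r. U = underS a) \<or> U = Field r) = ofilter"
    by (simp add: ofilter_underS_Field fun_eq_iff)
  show ?thesis
    unfolding eq istopology_def ofilter_def by blast
qed

lemma openin_initial_segment_topology:
  assumes "Well_order r" and "Field r \<noteq> {}"
  shows "openin (initial_segment_topology r) U \<longleftrightarrow>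
    (\<exists>a\<in>Field r. U = underS r a) \<or> U = Field r"
  using istopology_initial_segments[OF assms]
  by (simp add: initial_segment_topology_def topology_inverse')

lemma topspace_initial_segment_topology:
  assumes "Well_order r" and "Field r \<noteq> {}"
  shows "topspace (initial_segment_topology r) = Field r"
  unfolding topspace_def openin_initial_segment_topology[OF assms]
  by (auto simp: underS_def Field_def)

end

theory Submission
  imports Defs
begin

text \<open>
  For regular \<open>\<lambda>\<close>, failure of \<open>[\<lambda>, \<lambda>]\<close>-compactness can be witnessed in two ways: by an increasing
  \<open>\<lambda>\<close>-indexed chain of proper open sets covering the space, or by a \<open>\<lambda>\<close>-indexed family of points such
  that every point of the space has a neighbourhood containing fewer than \<open>\<lambda>\<close> of its members.
  Given a matrix \<open>B\<close> as in (a) and chains \<open>U\<^sub>\<beta>\<close> in the factors, the points \<open>x\<^sub>\<gamma>\<close> are obtained by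
  picking \<open>x\<^sub>\<gamma>(\<beta>)\<close> outside \<open>U\<^sub>\<beta>(\<alpha>)\<close> for the least \<open>\<alpha>\<close> with \<open>\<gamma> \<in> B\<^sub>\<alpha>\<^sub>,\<^sub>\<beta>\<close>. Conversely, a family of
  points \<open>x\<^sub>\<gamma>\<close> in \<open>\<mu>\<^sup>\<kappa>\<close> yields the matrix \<open>B\<^sub>\<alpha>\<^sub>,\<^sub>\<beta> = {\<gamma>. x\<^sub>\<gamma>(\<beta>) \<le> \<alpha>}\<close>, because \<open>[0, \<alpha>]\<close> is the least
  neighbourhood of \<open>\<alpha>\<close>.
\<close>

text \<open>Condition (a) as a predicate on the matrix, so that it can be carried along an
  isomorphism of \<open>mu\<close>. Intersecting with \<open>Field lam\<close> makes the empty
  \<open>F\<close> yield all of \<open>Field lam\<close>, not the whole type.\<close>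

definition small_intersection_matrix ::
    "'l rel \<Rightarrow> 'm rel \<Rightarrow> 'k rel \<Rightarrow> ('m \<Rightarrow> 'k \<Rightarrow> 'l set) \<Rightarrow> bool"
  where "small_intersection_matrix lam mu kap B \<longleftrightarrow>
    (\<forall>\<alpha>\<in>Field mu. \<forall>\<beta>\<in>Field kap. B \<alpha> \<beta> \<subseteq> Field lam) \<and>
    (\<forall>\<beta>\<in>Field kap. (\<Union>\<alpha>\<in>Field mu. B \<alpha> \<beta>) = Field lam) \<and>
    (\<forall>\<beta>\<in>Field kap. \<forall>\<alpha> \<alpha>'. (\<alpha>, \<alpha>') \<in> mu \<longrightarrow> B \<alpha> \<beta> \<subseteq> B \<alpha>' \<beta>) \<and>
    (\<forall>f \<in> Field kap \<rightarrow> Field mu. \<exists>F. finite F \<and> F \<subseteq> Field kap \<and>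
      |Field lam \<inter> (\<Inter>\<beta>\<in>F. B (f \<beta>) \<beta>)| <o lam)"

section \<open>Bounded sets and increasing chains of open sets\<close>

lemma Card_order_total:
  assumes "Card_order r" "a \<in> Field r" "b \<in> Field r"
  shows "(a, b) \<in> r \<or> (b, a) \<in> r"
proof -
  interpret wo_rel r
    using assms(1) by (simp add: wo_rel_def card_order_on_well_order_on)
  show ?thesis using TOTALS assms by blast
qed

text \<open>A cofinal subset of a regular cardinal has full size, so \<open>A\<close> is not
  cofinal: some \<open>a\<close> has no element of \<open>A\<close> strictly above it, and totality
  turns \<open>a\<close> into an upper bound.\<close>

lemma regularCard_small_bounded:
  assumes "Card_order r" "regularCard r" "A \<subseteq> Field r" "|A| <o r"
  obtains a where "a \<in> Field r" "\<And>b. b \<in> A \<Longrightarrow> (b, a) \<in> r"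
proof -
  have "\<not> cofinal A r"
    using assms not_ordLess_ordIso unfolding regularCard_def by blast
  then obtain a where a: "a \<in> Field r" "\<And>b. b \<in> A \<Longrightarrow> a = b \<or> (a, b) \<notin> r"
    unfolding cofinal_def by blast
  have "(b, a) \<in> r" if "b \<in> A" for b
    using a that assms(3) Card_order_total[OF assms(1), of a b] by auto
  with a(1) show thesis by (rule that)
qed

text \<open>Index a bad cover injectively by elements of \<open>r\<close>; the union of the members
  with index below \<alpha> uses fewer than \<open>r\<close> of them and hence misses a
  point.\<close>

lemma not_compact_imp_chain:
  assumes r: "Card_order r" "infinite (Field r)"
    and nc: "\<not> cardinal_interval_compact r r X"
  obtains U where "\<And>\<alpha>. openin X (U \<alpha>)"
    "\<And>\<alpha> \<alpha>'. (\<alpha>, \<alpha>') \<in> r \<Longrightarrow> U \<alpha> \<subseteq> U \<alpha>'"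
    "\<And>x. x \<in> topspace X \<Longrightarrow> \<exists>\<alpha>\<in>Field r. x \<in> U \<alpha>"
    "\<And>\<alpha>. \<alpha> \<in> Field r \<Longrightarrow> \<exists>x\<in>topspace X. x \<notin> U \<alpha>"
proof -
  obtain \<U> where op: "\<forall>V\<in>\<U>. openin X V" and cov: "\<Union>\<U> = topspace X" and le: "|\<U>| \<le>o r"
    and no: "\<not> (\<exists>\<V>\<subseteq>\<U>. \<Union>\<V> = topspace X \<and> |\<V>| <o r)"
    using nc unfolding cardinal_interval_compact_def by meson
  have "|\<U>| \<le>o |Field r|"
    by (rule ordLeq_ordIso_trans[OF le ordIso_symmetric[OF card_of_Field_ordIso[OF r(1)]]])
  then obtain h where inj: "inj_on h \<U>" and h: "h ` \<U> \<subseteq> Field r"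
    unfolding card_of_ordLeq[symmetric] by blast
  define \<V> where "\<V> \<alpha> = {V\<in>\<U>. h V \<in> underS r \<alpha>}" for \<alpha>
  have small: "|\<V> \<alpha>| <o r" if "\<alpha> \<in> Field r" for \<alpha>
  proof -
    have "inj_on h (\<V> \<alpha>)" "h ` \<V> \<alpha> \<subseteq> underS r \<alpha>"
      using inj by (auto simp: \<V>_def intro: inj_on_subset)
    then have "|\<V> \<alpha>| \<le>o |underS r \<alpha>|"
      unfolding card_of_ordLeq[symmetric] by blast
    then show ?thesis
      by (rule ordLeq_ordLess_trans[OF _ card_of_underS[OF r(1) that]])
  qed
  show thesis
  proof (rule that[of "\<lambda>\<alpha>. \<Union>(\<V> \<alpha>)"])
    show "openin X (\<Union>(\<V> \<alpha>))" for \<alpha>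
      using op by (auto simp: \<V>_def)
    show "\<Union>(\<V> \<alpha>) \<subseteq> \<Union>(\<V> \<alpha>')" if "(\<alpha>, \<alpha>') \<in> r" for \<alpha> \<alpha>'
    proof -
      interpret wo_rel r
        using r(1) by (simp add: wo_rel_def card_order_on_well_order_on)
      have "underS \<alpha> \<subseteq> underS \<alpha>'"
        by (rule underS_incr[OF TRANS ANTISYM that])
      then show ?thesis by (auto simp: \<V>_def)
    qed
    show "\<exists>\<alpha>\<in>Field r. x \<in> \<Union>(\<V> \<alpha>)" if x: "x \<in> topspace X" for x
    proof -
      obtain V where V: "V \<in> \<U>" "x \<in> V" using cov x by blast
      \<comment> \<open>The stages use strict initial segments, so \<open>V\<close> appears only
        after its own index; a larger index exists because an infinite cardinal has no last
        element.\<close>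
      then obtain \<alpha> where "\<alpha> \<in> Field r" "h V \<noteq> \<alpha>" "(h V, \<alpha>) \<in> r"
        using infinite_Card_order_limit[OF r, of "h V"] h by blast
      then show ?thesis using V by (auto simp: \<V>_def underS_def)
    qed
    show "\<exists>x\<in>topspace X. x \<notin> \<Union>(\<V> \<alpha>)" if "\<alpha> \<in> Field r" for \<alpha>
    proof -
      have sub: "\<V> \<alpha> \<subseteq> \<U>" by (auto simp: \<V>_def)
      with no small[OF that] have "\<Union>(\<V> \<alpha>) \<noteq> topspace X" by meson
      with sub cov show ?thesis by blast
    qed
  qed
qed

text \<open>Fewer than \<open>r\<close> members of the chain have indices bounded by some
  \<open>a\<close> by regularity, so a small subcover would force the proper set \<open>U a\<close>
  to be the whole space.\<close>

lemma chain_imp_not_compact: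
  assumes r: "Card_order r" "regularCard r"
    and op: "\<And>\<alpha>. \<alpha> \<in> Field r \<Longrightarrow> openin X (U \<alpha>)"
    and mono: "\<And>\<alpha> \<alpha>'. (\<alpha>, \<alpha>') \<in> r \<Longrightarrow> U \<alpha> \<subseteq> U \<alpha>'"
    and cov: "\<And>x. x \<in> topspace X \<Longrightarrow> \<exists>\<alpha>\<in>Field r. x \<in> U \<alpha>"
    and proper: "\<And>\<alpha>. \<alpha> \<in> Field r \<Longrightarrow> \<exists>x\<in>topspace X. x \<notin> U \<alpha>"
  shows "\<not> cardinal_interval_compact r r X"
proof
  assume "cardinal_interval_compact r r X"
  moreover have "\<forall>V\<in>U ` Field r. openin X V" using op by blast
  moreover have "\<Union>(U ` Field r) = topspace X"
    using op cov openin_subset by fastforce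
  moreover have "|U ` Field r| \<le>o r"
    by (rule ordLeq_ordIso_trans[OF card_of_image card_of_Field_ordIso[OF r(1)]])
  ultimately obtain \<V> where \<V>: "\<V> \<subseteq> U ` Field r" "\<Union>\<V> = topspace X" "|\<V>| <o r"
    unfolding cardinal_interval_compact_def by meson
  \<comment> \<open>Different indices may give the same open set; one index per member keeps
    \<open>A\<close> as small as \<open>\<V>\<close>.\<close>
  then obtain A where A: "A \<subseteq> Field r" "inj_on U A" "\<V> = U ` A"
    using subset_image_inj[of \<V> U "Field r"] by blast
  have "|A| <o r"
    by (rule ordLeq_ordLess_trans[OF card_of_ordLeqI[of U A \<V>] \<V>(3)]) (use A in auto)
  then obtain a where a: "a \<in> Field r" "\<And>b. b \<in> A \<Longrightarrow> (b, a) \<in> r"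
    using regularCard_small_bounded[OF r A(1)] by blast
  then have "\<Union>\<V> \<subseteq> U a" using A(3) mono by blast
  then show False using proper[OF a(1)] \<V>(2) by blast
qed

section \<open>Sparse families of points\<close>

text \<open>Pick \<open>x \<alpha>\<close> outside the stage \<open>U \<alpha>\<close> of a chain. A
  stage containing \<open>p\<close> is the required neighbourhood.\<close>

lemma not_compact_imp_sparse_points:
  assumes r: "Card_order r" "infinite (Field r)"
    and nc: "\<not> cardinal_interval_compact r r X"
  obtains x where "\<And>\<gamma>. \<gamma> \<in> Field r \<Longrightarrow> x \<gamma> \<in> topspace X"
    "\<And>p. p \<in> topspace X \<Longrightarrow> \<exists>V. openin X V \<and> p \<in> V \<and> |{\<gamma>\<in>Field r. x \<gamma> \<in> V}| <o r"
proof -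
  obtain U where op: "\<And>\<alpha>. openin X (U \<alpha>)"
    and mono: "\<And>\<alpha> \<alpha>'. (\<alpha>, \<alpha>') \<in> r \<Longrightarrow> U \<alpha> \<subseteq> U \<alpha>'"
    and cov: "\<And>x. x \<in> topspace X \<Longrightarrow> \<exists>\<alpha>\<in>Field r. x \<in> U \<alpha>"
    and proper: "\<And>\<alpha>. \<alpha> \<in> Field r \<Longrightarrow> \<exists>x\<in>topspace X. x \<notin> U \<alpha>"
    using not_compact_imp_chain[OF r nc] by metis
  obtain x where x: "\<And>\<alpha>. \<alpha> \<in> Field r \<Longrightarrow> x \<alpha> \<in> topspace X \<and> x \<alpha> \<notin> U \<alpha>"
    using proper by metis
  show thesis
  proof (rule that[of x])
    show "x \<gamma> \<in> topspace X" if "\<gamma> \<in> Field r" for \<gamma> using x that by blast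
    fix p assume "p \<in> topspace X"
    then obtain \<alpha> where \<alpha>: "\<alpha> \<in> Field r" "p \<in> U \<alpha>" using cov by blast
    have "{\<gamma>\<in>Field r. x \<gamma> \<in> U \<alpha>} \<subseteq> underS r \<alpha>"
    proof
      fix \<gamma> assume g: "\<gamma> \<in> {\<gamma>\<in>Field r. x \<gamma> \<in> U \<alpha>}"
      \<comment> \<open>If \<alpha> \<le> \<gamma>, then \<open>U \<alpha>\<close> lies in
        \<open>U \<gamma>\<close>, which misses \<open>x \<gamma>\<close>.\<close>
      then have "(\<alpha>, \<gamma>) \<notin> r" "\<gamma> \<noteq> \<alpha>" using x mono by blast+
      then show "\<gamma> \<in> underS r \<alpha>"
        using g \<alpha>(1) Card_order_total[OF r(1), of \<alpha> \<gamma>] by (auto simp: underS_def)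
    qed
    then have "|{\<gamma>\<in>Field r. x \<gamma> \<in> U \<alpha>}| <o r"
      by (rule ordLeq_ordLess_trans[OF card_of_mono1 card_of_underS[OF r(1) \<alpha>(1)]])
    then show "\<exists>V. openin X V \<and> p \<in> V \<and> |{\<gamma>\<in>Field r. x \<gamma> \<in> V}| <o r"
      using op \<alpha>(2) by blast
  qed
qed

lemma sparse_points_imp_not_compact:
  assumes r: "Card_order r" "infinite (Field r)" "regularCard r"
    and x: "\<And>\<gamma>. \<gamma> \<in> Field r \<Longrightarrow> x \<gamma> \<in> topspace X"
    and sparse: "\<And>p. p \<in> topspace X \<Longrightarrow>
      \<exists>V. openin X V \<and> p \<in> V \<and> |{\<gamma>\<in>Field r. x \<gamma> \<in> V}| <o r"
  shows "\<not> cardinal_interval_compact r r X"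
proof -
  interpret wo_rel r
    using r(1) by (simp add: wo_rel_def card_order_on_well_order_on)
  \<comment> \<open>The largest open set avoiding the tail of points from \<delta> on; it grows with
    \<delta> and misses \<open>x \<delta>\<close> itself.\<close>
  define U where "U \<delta> = \<Union>{V. openin X V \<and> (\<forall>\<gamma>. (\<delta>, \<gamma>) \<in> r \<longrightarrow> x \<gamma> \<notin> V)}" for \<delta>
  show ?thesis
  proof (rule chain_imp_not_compact[OF r(1,3), where U = U])
    show "openin X (U \<alpha>)" for \<alpha> unfolding U_def by blast
    show "U \<alpha> \<subseteq> U \<alpha>'" if "(\<alpha>, \<alpha>') \<in> r" for \<alpha> \<alpha>'
      unfolding U_def using that TRANS by (blast dest: transD)
    show "\<exists>y\<in>topspace X. y \<notin> U \<alpha>" if "\<alpha> \<in> Field r" for \<alpha>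
    proof (intro bexI[of _ "x \<alpha>"])
      have "(\<alpha>, \<alpha>) \<in> r" using REFL that by (auto dest: refl_onD)
      then show "x \<alpha> \<notin> U \<alpha>" unfolding U_def by blast
      show "x \<alpha> \<in> topspace X" using x that .
    qed
    fix p assume "p \<in> topspace X"
    then obtain V where V: "openin X V" "p \<in> V" "|{\<gamma>\<in>Field r. x \<gamma> \<in> V}| <o r"
      using sparse by blast
    obtain a where a: "a \<in> Field r" "\<And>\<gamma>. \<gamma> \<in> {\<gamma>\<in>Field r. x \<gamma> \<in> V} \<Longrightarrow> (\<gamma>, a) \<in> r"
      by (rule regularCard_small_bounded[OF r(1,3) _ V(3)]) auto
    \<comment> \<open>The bound \<open>a\<close> may itself index a point in \<open>V\<close>, so
      the tail avoided by \<open>V\<close> starts at a strictly larger \<open>d\<close>.\<close>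
    obtain d where d: "d \<in> Field r" "a \<noteq> d" "(a, d) \<in> r"
      using infinite_Card_order_limit[OF r(1,2) a(1)] by blast
    have "x \<gamma> \<notin> V" if "(d, \<gamma>) \<in> r" for \<gamma>
    proof
      assume "x \<gamma> \<in> V"
      then have "(\<gamma>, a) \<in> r" using a(2) that by (auto simp: Field_def)
      then have "(d, a) \<in> r" using that TRANS by (blast dest: transD)
      then show False using d ANTISYM by (blast dest: antisymD)
    qed
    then show "\<exists>\<alpha>\<in>Field r. p \<in> U \<alpha>" using V d(1) unfolding U_def by blast
  qed
qed

section \<open>The initial segment topology\<close>

text \<open>The proper initial segments themselves form the required chain.\<close>

lemma initial_segment_topology_not_compact:
  assumes r: "Card_order r" "infinite (Field r)" "regularCard r"
  shows "\<not> cardinal_interval_compact r r (initial_segment_topology r)"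
proof -
  have W: "Well_order r" and ne: "Field r \<noteq> {}"
    using r(1,2) by (auto simp: card_order_on_well_order_on)
  interpret wo_rel r using W by (simp add: wo_rel_def)
  show ?thesis
  proof (rule chain_imp_not_compact[OF r(1,3), where U = underS])
    show "openin (initial_segment_topology r) (underS \<alpha>)" if "\<alpha> \<in> Field r" for \<alpha>
      using that by (auto simp: openin_initial_segment_topology[OF W ne])
    show "underS \<alpha> \<subseteq> underS \<alpha>'" if "(\<alpha>, \<alpha>') \<in> r" for \<alpha> \<alpha>'
      by (rule underS_incr[OF TRANS ANTISYM that])
    show "\<exists>\<alpha>\<in>Field r. x \<in> underS \<alpha>" if "x \<in> topspace (initial_segment_topology r)" for x
      using that infinite_Card_order_limit[OF r(1,2), of x]
      by (auto simp: topspace_initial_segment_topology[OF W ne] underS_def)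
    show "\<exists>x\<in>topspace (initial_segment_topology r). x \<notin> underS \<alpha>" if "\<alpha> \<in> Field r" for \<alpha>
      using that by (auto simp: topspace_initial_segment_topology[OF W ne] underS_def)
  qed
qed

text \<open>The open sets are exactly the order filters of \<open>r\<close>, so a neighbourhood of
  \<open>b\<close> contains all of [0, \<open>b\<close>].\<close>

lemma openin_initial_segment_down_closed:
  assumes "Well_order r" "openin (initial_segment_topology r) U" "b \<in> U" "(a, b) \<in> r"
  shows "a \<in> U"
proof -
  interpret wo_rel r using assms(1) by (simp add: wo_rel_def)
  have "Field r \<noteq> {}" using assms(4) by (auto simp: Field_def)
  then have "ofilter U"
    using assms(2) openin_initial_segment_topology[OF assms(1)] ofilter_underS_Field by blast
  then show ?thesis using assms(3,4) by (auto simp: ofilter_def under_def)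
qed

section \<open>Between matrices and products\<close>

text \<open>For a point \<open>p\<close>, let \<open>f \<beta>\<close> be a stage containing
  \<open>p \<beta>\<close>. The finite \<open>F\<close> that (iii) gives for \<open>f\<close>
  determines a basic neighbourhood of \<open>p\<close>, and the indices of the points in it lie in
  the small intersection.\<close>

lemma matrix_imp_product_not_compact:
  fixes X :: "'k \<Rightarrow> 'c topology"
  assumes lam: "Card_order lam" "infinite (Field lam)" "regularCard lam"
    and mu: "Card_order mu" "infinite (Field mu)"
    and B: "small_intersection_matrix lam mu kap B"
    and X: "\<And>\<beta>. \<beta> \<in> Field kap \<Longrightarrow> \<not> cardinal_interval_compact mu mu (X \<beta>)"
  shows "\<not> cardinal_interval_compact lam lam (product_topology X (Field kap))"
proof -
  interpret wo_rel mu
    using mu(1) by (simp add: wo_rel_def card_order_on_well_order_on)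
  have "\<exists>U. (\<forall>\<alpha>. openin (X \<beta>) (U \<alpha>)) \<and> (\<forall>\<alpha> \<alpha>'. (\<alpha>, \<alpha>') \<in> mu \<longrightarrow> U \<alpha> \<subseteq> U \<alpha>') \<and>
      (\<forall>x\<in>topspace (X \<beta>). \<exists>\<alpha>\<in>Field mu. x \<in> U \<alpha>) \<and>
      (\<forall>\<alpha>\<in>Field mu. \<exists>x\<in>topspace (X \<beta>). x \<notin> U \<alpha>)" if "\<beta> \<in> Field kap" for \<beta>
    by (rule not_compact_imp_chain[OF mu X[OF that]]) blast
  then obtain U where op: "\<And>\<beta> \<alpha>. \<beta> \<in> Field kap \<Longrightarrow> openin (X \<beta>) (U \<beta> \<alpha>)"
    and mono: "\<And>\<beta> \<alpha> \<alpha>'. \<beta> \<in> Field kap \<Longrightarrow> (\<alpha>, \<alpha>') \<in> mu \<Longrightarrow> U \<beta> \<alpha> \<subseteq> U \<beta> \<alpha>'"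
    and cov: "\<And>\<beta> x. \<beta> \<in> Field kap \<Longrightarrow> x \<in> topspace (X \<beta>) \<Longrightarrow> \<exists>\<alpha>\<in>Field mu. x \<in> U \<beta> \<alpha>"
    and proper: "\<And>\<beta> \<alpha>. \<beta> \<in> Field kap \<Longrightarrow> \<alpha> \<in> Field mu \<Longrightarrow> \<exists>x\<in>topspace (X \<beta>). x \<notin> U \<beta> \<alpha>"
    by metis
  define m where "m \<gamma> \<beta> = minim {\<alpha>\<in>Field mu. \<gamma> \<in> B \<alpha> \<beta>}" for \<gamma> \<beta>
  have m: "m \<gamma> \<beta> \<in> Field mu" "\<gamma> \<in> B (m \<gamma> \<beta>) \<beta>" if "\<beta> \<in> Field kap" "\<gamma> \<in> Field lam" for \<gamma> \<beta>
  proof -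
    have "{\<alpha>\<in>Field mu. \<gamma> \<in> B \<alpha> \<beta>} \<noteq> {}"
      using B that unfolding small_intersection_matrix_def by blast
    from minim_in[OF _ this] show "m \<gamma> \<beta> \<in> Field mu" "\<gamma> \<in> B (m \<gamma> \<beta>) \<beta>"
      by (auto simp: m_def)
  qed
  have "\<forall>\<gamma> \<beta>. \<exists>z. \<beta> \<in> Field kap \<longrightarrow> \<gamma> \<in> Field lam \<longrightarrow>
      z \<in> topspace (X \<beta>) \<and> z \<notin> U \<beta> (m \<gamma> \<beta>)"
    using proper m(1) by blast
  then obtain y where y: "\<And>\<beta> \<gamma>. \<beta> \<in> Field kap \<Longrightarrow> \<gamma> \<in> Field lam \<Longrightarrow>
      y \<gamma> \<beta> \<in> topspace (X \<beta>) \<and> y \<gamma> \<beta> \<notin> U \<beta> (m \<gamma> \<beta>)"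
    by metis
  have inB: "\<gamma> \<in> B \<alpha> \<beta>"
    if "\<beta> \<in> Field kap" "\<gamma> \<in> Field lam" "\<alpha> \<in> Field mu" "y \<gamma> \<beta> \<in> U \<beta> \<alpha>" for \<alpha> \<beta> \<gamma>
  proof -
    \<comment> \<open>Otherwise \<open>U \<beta> \<alpha>\<close> would lie in
      \<open>U \<beta> (m \<gamma> \<beta>)\<close>, which misses
      \<open>y \<gamma> \<beta>\<close>.\<close>
    have "(\<alpha>, m \<gamma> \<beta>) \<notin> mu" using that y mono by blast
    then have "(m \<gamma> \<beta>, \<alpha>) \<in> mu" using Card_order_total[OF mu(1) that(3) m(1)] that by blast
    then show ?thesis using B m(2) that unfolding small_intersection_matrix_def by blast
  qed
  show ?thesis
  proof (rule sparse_points_imp_not_compact[OF lam, where x = "\<lambda>\<gamma>. restrict (y \<gamma>) (Field kap)"])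
    show "restrict (y \<gamma>) (Field kap) \<in> topspace (product_topology X (Field kap))"
      if "\<gamma> \<in> Field lam" for \<gamma>
      using y that by auto
    fix p assume p: "p \<in> topspace (product_topology X (Field kap))"
    then have "p \<beta> \<in> topspace (X \<beta>)" if "\<beta> \<in> Field kap" for \<beta>
      using that by (auto simp: PiE_iff)
    then have "\<exists>\<alpha>. \<alpha> \<in> Field mu \<and> p \<beta> \<in> U \<beta> \<alpha>" if "\<beta> \<in> Field kap" for \<beta>
      using cov that by blast
    then obtain f where f: "\<And>\<beta>. \<beta> \<in> Field kap \<Longrightarrow> f \<beta> \<in> Field mu \<and> p \<beta> \<in> U \<beta> (f \<beta>)"
      by metis
    then have "f \<in> Field kap \<rightarrow> Field mu" by blast
    then obtain F where F: "finite F" "F \<subseteq> Field kap"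
        "|Field lam \<inter> (\<Inter>\<beta>\<in>F. B (f \<beta>) \<beta>)| <o lam"
      using B unfolding small_intersection_matrix_def by blast
    \<comment> \<open>Only the finitely many coordinates in \<open>F\<close> are constrained, which
      makes this box open.\<close>
    define V where "V = (\<Pi>\<^sub>E \<beta>\<in>Field kap. if \<beta> \<in> F then U \<beta> (f \<beta>) else topspace (X \<beta>))"
    have "openin (product_topology X (Field kap)) V"
      unfolding V_def
    proof (rule product_topology_basis)
      show "openin (X \<beta>) (if \<beta> \<in> F then U \<beta> (f \<beta>) else topspace (X \<beta>))" for \<beta>
        using op F(2) by auto
      show "finite {\<beta>. (if \<beta> \<in> F then U \<beta> (f \<beta>) else topspace (X \<beta>)) \<noteq> topspace (X \<beta>)}"
        by (rule finite_subset[OF _ F(1)]) auto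
    qed
    moreover have "p \<in> V"
      using p f by (auto simp: V_def PiE_iff)
    moreover have sub: "{\<gamma>\<in>Field lam. restrict (y \<gamma>) (Field kap) \<in> V}
        \<subseteq> Field lam \<inter> (\<Inter>\<beta>\<in>F. B (f \<beta>) \<beta>)"
    proof safe
      fix \<gamma> \<beta> assume g: "\<gamma> \<in> Field lam" "restrict (y \<gamma>) (Field kap) \<in> V" "\<beta> \<in> F"
      then have b: "\<beta> \<in> Field kap" using F(2) by blast
      have "y \<gamma> \<beta> \<in> U \<beta> (f \<beta>)"
        using PiE_mem[OF g(2)[unfolded V_def] b] g(3) b by simp
      then show "\<gamma> \<in> B (f \<beta>) \<beta>" using inB g(1) b f by blast
    qed
    ultimately show "\<exists>V. openin (product_topology X (Field kap)) V \<and> p \<in> V \<and>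
        |{\<gamma>\<in>Field lam. restrict (y \<gamma>) (Field kap) \<in> V}| <o lam"
      using ordLeq_ordLess_trans[OF card_of_mono1[OF sub] F(3)] by blast
  qed
qed

text \<open>A function \<open>f\<close> into \<open>mu\<close> is itself a point of the product. A
  basic box around it constrains finitely many coordinates, and by downward closure contains every
  \<open>x \<gamma>\<close> lying below \<open>f\<close> on those coordinates.\<close>

lemma initial_segment_product_not_compact_imp_matrix:
  assumes lam: "Card_order lam" "infinite (Field lam)"
    and mu: "Card_order mu" "infinite (Field mu)"
    and nc: "\<not> cardinal_interval_compact lam lam
      (product_topology (\<lambda>_. initial_segment_topology mu) (Field kap))"
  shows "\<exists>B. small_intersection_matrix lam mu kap B"
proof -
  have W: "Well_order mu" and ne: "Field mu \<noteq> {}"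
    using mu by (auto simp: card_order_on_well_order_on)
  interpret wo_rel mu using W by (simp add: wo_rel_def)
  let ?P = "product_topology (\<lambda>_. initial_segment_topology mu) (Field kap)"
  have top: "topspace ?P = Field kap \<rightarrow>\<^sub>E Field mu"
    by (simp add: topspace_initial_segment_topology[OF W ne])
  obtain x where x: "\<And>\<gamma>. \<gamma> \<in> Field lam \<Longrightarrow> x \<gamma> \<in> topspace ?P"
    and sparse: "\<And>p. p \<in> topspace ?P \<Longrightarrow>
      \<exists>V. openin ?P V \<and> p \<in> V \<and> |{\<gamma>\<in>Field lam. x \<gamma> \<in> V}| <o lam"
    by (rule not_compact_imp_sparse_points[OF lam nc]) (rule that)
  define B where "B \<alpha> \<beta> = {\<gamma>\<in>Field lam. (x \<gamma> \<beta>, \<alpha>) \<in> mu}" for \<alpha> \<beta>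
  have "\<exists>F. finite F \<and> F \<subseteq> Field kap \<and> |Field lam \<inter> (\<Inter>\<beta>\<in>F. B (f \<beta>) \<beta>)| <o lam"
    if f: "f \<in> Field kap \<rightarrow> Field mu" for f
  proof -
    have "restrict f (Field kap) \<in> topspace ?P" unfolding top using f by auto
    then obtain V where V: "openin ?P V" "restrict f (Field kap) \<in> V"
        "|{\<gamma>\<in>Field lam. x \<gamma> \<in> V}| <o lam"
      using sparse by blast
    from product_topology_open_contains_basis[OF V(1,2)] obtain W where
      W1: "restrict f (Field kap) \<in> (\<Pi>\<^sub>E \<beta>\<in>Field kap. W \<beta>)"
      and W2: "\<And>\<beta>. openin (initial_segment_topology mu) (W \<beta>)"
      and W3: "finite {\<beta>. W \<beta> \<noteq> topspace (initial_segment_topology mu)}"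
      and W4: "(\<Pi>\<^sub>E \<beta>\<in>Field kap. W \<beta>) \<subseteq> V"
      by blast
    \<comment> \<open>The coordinates that the box really constrains; this is the finite set
      demanded by (iii).\<close>
    define F where "F = {\<beta>\<in>Field kap. W \<beta> \<noteq> topspace (initial_segment_topology mu)}"
    have "Field lam \<inter> (\<Inter>\<beta>\<in>F. B (f \<beta>) \<beta>) \<subseteq> {\<gamma>\<in>Field lam. x \<gamma> \<in> V}"
    proof safe
      fix \<gamma> assume g: "\<gamma> \<in> Field lam" "\<gamma> \<in> (\<Inter>\<beta>\<in>F. B (f \<beta>) \<beta>)"
      have xg: "x \<gamma> \<in> Field kap \<rightarrow>\<^sub>E Field mu" using x[OF g(1)] unfolding top .
      have "x \<gamma> \<beta> \<in> W \<beta>" if b: "\<beta> \<in> Field kap" for \<beta>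
      proof (cases "\<beta> \<in> F")
        case True
        then have "(x \<gamma> \<beta>, f \<beta>) \<in> mu" using g(2) by (auto simp: B_def)
        moreover have "f \<beta> \<in> W \<beta>" using PiE_mem[OF W1 b] b by simp
        ultimately show ?thesis
          using openin_initial_segment_down_closed[OF W W2] by blast
      next
        case False
        then show ?thesis
          using b xg by (auto simp: F_def topspace_initial_segment_topology[OF W ne])
      qed
      then have "x \<gamma> \<in> (\<Pi>\<^sub>E \<beta>\<in>Field kap. W \<beta>)" using xg by (simp add: PiE_iff)
      then show "x \<gamma> \<in> V" using W4 by blast
    qed
    then have "|Field lam \<inter> (\<Inter>\<beta>\<in>F. B (f \<beta>) \<beta>)| <o lam"
      by (rule ordLeq_ordLess_trans[OF card_of_mono1 V(3)])
    moreover have "finite F" by (rule finite_subset[OF _ W3]) (auto simp: F_def)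
    ultimately show ?thesis by (auto simp: F_def)
  qed
  moreover have "(\<Union>\<alpha>\<in>Field mu. B \<alpha> \<beta>) = Field lam" if "\<beta> \<in> Field kap" for \<beta>
  proof -
    \<comment> \<open>By reflexivity, \<gamma> enters column \<beta> at stage
      \<open>x \<gamma> \<beta>\<close>.\<close>
    have "\<gamma> \<in> B (x \<gamma> \<beta>) \<beta> \<and> x \<gamma> \<beta> \<in> Field mu" if "\<gamma> \<in> Field lam" for \<gamma>
      using x[OF that, unfolded top] \<open>\<beta> \<in> Field kap\<close> that REFL
      by (auto simp: B_def PiE_iff dest: refl_onD)
    then show ?thesis by (auto simp: B_def)
  qed
  moreover have "B \<alpha> \<beta> \<subseteq> B \<alpha>' \<beta>" if "(\<alpha>, \<alpha>') \<in> mu" for \<alpha> \<alpha>' \<beta>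
    using that TRANS by (auto simp: B_def dest: transD)
  ultimately have "small_intersection_matrix lam mu kap B"
    unfolding small_intersection_matrix_def by (auto simp: B_def)
  then show ?thesis by blast
qed

section \<open>Moving cardinals between types\<close>

text \<open>The two cardinals enter only through comparisons of size.\<close>

lemma cardinal_interval_compact_cong:
  fixes X :: "'c topology"
  assumes "(r, r') \<in> ordIso" "(s, s') \<in> ordIso"
  shows "cardinal_interval_compact r s X \<longleftrightarrow> cardinal_interval_compact r' s' X"
proof -
  have "|A| <o r \<longleftrightarrow> |A| <o r'" for A :: "'c set set"
    using ordLess_ordIso_trans[OF _ assms(1)]
      ordLess_ordIso_trans[OF _ ordIso_symmetric[OF assms(1)]] by blast
  moreover have "|A| \<le>o s \<longleftrightarrow> |A| \<le>o s'" for A :: "'c set set"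
    using ordLeq_ordIso_trans[OF _ assms(2)]
      ordLeq_ordIso_trans[OF _ ordIso_symmetric[OF assms(2)]] by blast
  ultimately show ?thesis unfolding cardinal_interval_compact_def by simp
qed

lemma small_intersection_matrix_iso:
  assumes iso: "iso mu mu' g" and W: "Well_order mu" "Well_order mu'"
    and B: "small_intersection_matrix lam mu' kap B"
  shows "small_intersection_matrix lam mu kap (\<lambda>\<alpha>. B (g \<alpha>))"
proof -
  have img: "g ` Field mu = Field mu'"
    using iso by (simp add: iso_def bij_betw_def)
  have mono: "(g a, g b) \<in> mu'" if "(a, b) \<in> mu" for a b
    using iso that embed_compat[of mu mu' g] unfolding iso_def compat_def by blast
  show ?thesis
    unfolding small_intersection_matrix_def
  proof (intro conjI ballI allI impI)
    show "B (g \<alpha>) \<beta> \<subseteq> Field lam" if "\<alpha> \<in> Field mu" "\<beta> \<in> Field kap" for \<alpha> \<beta>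
      using B that img unfolding small_intersection_matrix_def by blast
    show "(\<Union>\<alpha>\<in>Field mu. B (g \<alpha>) \<beta>) = Field lam" if "\<beta> \<in> Field kap" for \<beta>
      using B that unfolding small_intersection_matrix_def img[symmetric] by auto
    show "B (g \<alpha>) \<beta> \<subseteq> B (g \<alpha>') \<beta>" if "\<beta> \<in> Field kap" "(\<alpha>, \<alpha>') \<in> mu" for \<alpha> \<alpha>' \<beta>
      using B that mono unfolding small_intersection_matrix_def by blast
    fix f assume "f \<in> Field kap \<rightarrow> Field mu"
    \<comment> \<open>The finite set for \<open>f\<close> is the one that the original matrix
      provides for \<open>g \<circ> f\<close>.\<close>
    then have gf: "g \<circ> f \<in> Field kap \<rightarrow> Field mu'" using img by fastforce
    have "\<forall>f \<in> Field kap \<rightarrow> Field mu'. \<exists>F. finite F \<and> F \<subseteq> Field kap \<and>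
        |Field lam \<inter> (\<Inter>\<beta>\<in>F. B (f \<beta>) \<beta>)| <o lam"
      using B unfolding small_intersection_matrix_def by (elim conjE)
    from bspec[OF this gf] show "\<exists>F. finite F \<and> F \<subseteq> Field kap \<and>
        |Field lam \<inter> (\<Inter>\<beta>\<in>F. B (g (f \<beta>)) \<beta>)| <o lam"
      by (simp only: comp_apply)
  qed
qed

text \<open>
  The copy of a cardinal on another type is itself a cardinal order there, which spares a
  homeomorphism between the two products of initial segment topologies.
\<close>

lemma regular_cardinal_copy:
  fixes mu :: "'m rel"
  assumes mu: "Card_order mu" "infinite (Field mu)" "regularCard mu"
    and le: "mu \<le>o |UNIV :: 'c set|"
  obtains mu' :: "'c rel" and g where "Card_order mu'" "infinite (Field mu')" "regularCard mu'"
    "iso mu mu' g"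
proof -
  have "|Field mu| \<le>o |UNIV :: 'c set|"
    by (rule ordIso_ordLeq_trans[OF card_of_Field_ordIso[OF mu(1)] le])
  then obtain h :: "'m \<Rightarrow> 'c" where h: "inj_on h (Field mu)"
    unfolding card_of_ordLeq[symmetric] by blast
  have W: "Well_order mu" using mu(1) by (rule card_order_on_well_order_on)
  let ?mu' = "dir_image mu h"
  have oi: "(mu, ?mu') \<in> ordIso" using dir_image_ordIso[OF W h] .
  have co: "Card_order ?mu'" using Card_order_ordIso2[OF mu(1) oi] .
  have "iso mu ?mu' h" using dir_image_iso[OF W h] .
  moreover have inf: "infinite (Field ?mu')"
    using h mu(2) by (simp add: dir_image_Field finite_image_iff)
  moreover have "Cinfinite mu" using mu by (simp add: cinfinite_def)
  then have "regularCard ?mu'" using oi mu(3) regularCard_ordIso by blast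
  ultimately show thesis using that co by blast
qed

theorem theorem2:
  fixes lam :: "'l rel" and mu :: "'m rel" and kap :: "'k rel"
  assumes "Card_order lam" and "infinite (Field lam)" and "regularCard lam"
    and "Card_order mu" and "infinite (Field mu)" and "regularCard mu"
    and "Card_order kap" and "infinite (Field kap)"
    \<comment> \<open>The spaces in the second condition have their points in the type \<open>'c\<close>, an arbitrary
      universe that only has to be large enough to contain a copy of \<open>mu\<close>.\<close>
    and "mu \<le>o |UNIV :: 'c set|"
  shows
    "((\<exists>B :: 'm \<Rightarrow> 'k \<Rightarrow> 'l set.
        (\<forall>\<alpha>\<in>Field mu. \<forall>\<beta>\<in>Field kap. B \<alpha> \<beta> \<subseteq> Field lam) \<and>
        (\<forall>\<beta>\<in>Field kap. (\<Union>\<alpha>\<in>Field mu. B \<alpha> \<beta>) = Field lam) \<and>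
        (\<forall>\<beta>\<in>Field kap. \<forall>\<alpha> \<alpha>'. (\<alpha>, \<alpha>') \<in> mu \<longrightarrow> B \<alpha> \<beta> \<subseteq> B \<alpha>' \<beta>) \<and>
        (\<forall>f \<in> Field kap \<rightarrow> Field mu. \<exists>F. finite F \<and> F \<subseteq> Field kap \<and>
          |Field lam \<inter> (\<Inter>\<beta>\<in>F. B (f \<beta>) \<beta>)| <o lam))
      \<longleftrightarrow>
      (\<forall>X :: 'k \<Rightarrow> 'c topology.
        (\<forall>\<beta>\<in>Field kap. \<not> cardinal_interval_compact mu mu (X \<beta>)) \<longrightarrow>
        \<not> cardinal_interval_compact lam lam (product_topology X (Field kap))))
    \<and>
    ((\<forall>X :: 'k \<Rightarrow> 'c topology.
        (\<forall>\<beta>\<in>Field kap. \<not> cardinal_interval_compact mu mu (X \<beta>)) \<longrightarrow>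
        \<not> cardinal_interval_compact lam lam (product_topology X (Field kap)))
      \<longleftrightarrow>
      \<not> cardinal_interval_compact lam lam
        (product_topology (\<lambda>_. initial_segment_topology mu) (Field kap)))"
proof -
  note lam = assms(1-3) and mu = assms(4-6)
  have ab: "\<not> cardinal_interval_compact lam lam (product_topology X (Field kap))"
    if "\<exists>B. small_intersection_matrix lam mu kap B"
      "\<forall>\<beta>\<in>Field kap. \<not> cardinal_interval_compact mu mu (X \<beta>)" for X :: "'k \<Rightarrow> 'c topology"
    using that matrix_imp_product_not_compact[OF lam mu(1,2)] by blast
  have ac: "\<not> cardinal_interval_compact lam lam
      (product_topology (\<lambda>_. initial_segment_topology mu) (Field kap))"
    \<comment> \<open>This is separate from \<open>ab\<close> because these factors have points in
      \<open>'m\<close>, while the spaces in (b) have points in \<open>'c\<close>.\<close>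
    if "\<exists>B. small_intersection_matrix lam mu kap B"
    using that matrix_imp_product_not_compact[OF lam mu(1,2) _
        initial_segment_topology_not_compact[OF mu]] by blast
  have ba: "\<exists>B. small_intersection_matrix lam mu kap B"
    if b: "\<forall>X :: 'k \<Rightarrow> 'c topology.
        (\<forall>\<beta>\<in>Field kap. \<not> cardinal_interval_compact mu mu (X \<beta>)) \<longrightarrow>
        \<not> cardinal_interval_compact lam lam (product_topology X (Field kap))"
  proof -
    \<comment> \<open>Condition (b) speaks only of spaces over \<open>'c\<close>, so it is applied
      to a copy of \<open>mu\<close> there; the resulting matrix is then pulled back along
      \<open>g\<close>.\<close>
    obtain mu' :: "'c rel" and g where mu': "Card_order mu'" "infinite (Field mu')"
        "regularCard mu'" and g: "iso mu mu' g"
      by (rule regular_cardinal_copy[OF mu assms(9)])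
    have W: "Well_order mu" "Well_order mu'"
      using mu(1) mu'(1) by (simp_all add: card_order_on_well_order_on)
    have "(mu, mu') \<in> ordIso" using W g by (auto simp: ordIso_def)
    then have "\<not> cardinal_interval_compact mu mu (initial_segment_topology mu')"
      using initial_segment_topology_not_compact[OF mu'] cardinal_interval_compact_cong by blast
    then have "\<not> cardinal_interval_compact lam lam
        (product_topology (\<lambda>_. initial_segment_topology mu') (Field kap))"
      using b[rule_format, of "\<lambda>_. initial_segment_topology mu'"] by blast
    then obtain B where "small_intersection_matrix lam mu' kap B"
      using initial_segment_product_not_compact_imp_matrix[OF lam(1,2) mu'(1,2)] by blast
    then show ?thesis using small_intersection_matrix_iso[OF g W] by blast
  qed
  have ca: "\<exists>B. small_intersection_matrix lam mu kap B"
    if "\<not> cardinal_interval_compact lam lam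
      (product_topology (\<lambda>_. initial_segment_topology mu) (Field kap))"
    using initial_segment_product_not_compact_imp_matrix[OF lam(1,2) mu(1,2) that] .
  show ?thesis
    unfolding small_intersection_matrix_def[symmetric]
    using ab ac ba ca by blast
qed

end
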